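(* Let $\psi(p)=(\phi_1(a,b),\phi_2(a,b))$, $p=(a,b)$, be a bicomplex function defined on a domain $G\subseteq\mathrm{B}$, where $\phi_1,\phi_2$ are complex-valued. Then $\psi$ is holomorphic in $G$ if and only if the complex functions $\phi_1(a,b)$ and $\phi_2(a,b)$ are holomorphic in $G$ and satisfy there the bicomplex Cauchy–Riemann equations $$\frac{\partial\phi_1}{\partial a}=\frac{\partial\phi_2}{\partial b},\qquad \frac{\partial\phi_2}{\partial a}=-\frac{\partial\phi_1}{\partial b}.$$
   Context: $\mathrm{B}=\mathbb{C}^2$ is the space of bicomplex numbers $p=(a,b)$, $a,b\in\mathbb{C}$, with componentwise addition and the commutative multiplication $(a,b)\odot(c,d)=(ac-bd,\ bc+ad)$. The norm is $\|(a,b)\|=\sqrt{|a|^2+|b|^2}$. A bicomplex number $(a,b)$ is singular if $a^2+b^2=0$, and nonsingular otherwise; a nonsingular $(a,b)$ has the inverse $\left(\frac{a}{a^2+b^2},\frac{-b}{a^2+b^2}\right)$, and $r/q=r\odot q^{-1}$ for nonsingular $q$. A domain is a connected open set. A bicomplex function $\psi$ is holomorphic at $p$ if it is defined in a neighbourhood of $p$ and the derivative $$\psi'(p)=\lim_{\Delta p\to 0,\ \Delta p\ \text{nonsingular}}\frac{\psi(p+\Delta p)-\psi(p)}{\Delta p}$$ exists (the limit being taken over nonsingular $\Delta p$ only); it is holomorphic in $G$ if it is holomorphic at every point of $G$. A complex-valued function $\phi(a,b)$ on $G$ is holomorphic in $G$ if it is holomorphic in both complex variables, i.e. the complex partial derivatives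 $\partial\phi/\partial a$ and $\partial\phi/\partial b$ exist throughout $G$. *)

theory Defs
  imports "HOL-Analysis.Analysis"
begin

text \<open>
  The product type already carries the componentwise addition, the Euclidean norm
  \<open>sqrt ((norm a)\<^sup>2 + (norm b)\<^sup>2)\<close> and the topology wanted here;
  only the bicomplex multiplicative structure has to be added.
\<close>

type_synonym bicomplex = "complex \<times> complex"

definition bc_mult :: "bicomplex \<Rightarrow> bicomplex \<Rightarrow> bicomplex" (infixl "\<odot>" 70) where
  "p \<odot> q = (fst p * fst q - snd p * snd q, snd p * fst q + fst p * snd q)"

definition bc_singular :: "bicomplex \<Rightarrow> bool" where
  "bc_singular p \<longleftrightarrow> (fst p)\<^sup>2 + (snd p)\<^sup>2 = 0"

definition bc_inverse :: "bicomplex \<Rightarrow> bicomplex" where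
  "bc_inverse p =
     (fst p / ((fst p)\<^sup>2 + (snd p)\<^sup>2), - snd p / ((fst p)\<^sup>2 + (snd p)\<^sup>2))"

definition bc_divide :: "bicomplex \<Rightarrow> bicomplex \<Rightarrow> bicomplex" where
  "bc_divide r q = r \<odot> bc_inverse q"

lemma bc_mult_inverse: "\<not> bc_singular p \<Longrightarrow> p \<odot> bc_inverse p = (1, 0)"
  by (auto simp: bc_singular_def bc_mult_def bc_inverse_def power2_eq_square
      simp flip: add_divide_distrib)

definition bc_has_derivative :: "(bicomplex \<Rightarrow> bicomplex) \<Rightarrow> bicomplex \<Rightarrow> bicomplex \<Rightarrow> bool" where
  "bc_has_derivative \<psi> D p \<longleftrightarrow>
     ((\<lambda>h. bc_divide (\<psi> (p + h) - \<psi> p) h) \<longlongrightarrow> D) (at 0 within {h. \<not> bc_singular h})"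

text \<open>
  A function defined on \<open>G\<close> is represented by a total function together with \<open>G\<close>.
  That it is defined in a neighbourhood of \<open>p\<close> is \<open>p \<in> interior G\<close>; the limit then
  does not depend on the values outside \<open>G\<close>.
\<close>

definition bc_holomorphic_at :: "(bicomplex \<Rightarrow> bicomplex) \<Rightarrow> bicomplex set \<Rightarrow> bicomplex \<Rightarrow> bool" where
  "bc_holomorphic_at \<psi> G p \<longleftrightarrow> p \<in> interior G \<and> (\<exists>D. bc_has_derivative \<psi> D p)"

definition bc_holomorphic_on :: "(bicomplex \<Rightarrow> bicomplex) \<Rightarrow> bicomplex set \<Rightarrow> bool" where
  "bc_holomorphic_on \<psi> G \<longleftrightarrow> (\<forall>p\<in>G. bc_holomorphic_at \<psi> G p)"

definition partial_a :: "(bicomplex \<Rightarrow> complex) \<Rightarrow> bicomplex \<Rightarrow> complex" where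
  "partial_a \<phi> p = deriv (\<lambda>z. \<phi> (z, snd p)) (fst p)"

definition partial_b :: "(bicomplex \<Rightarrow> complex) \<Rightarrow> bicomplex \<Rightarrow> complex" where
  "partial_b \<phi> p = deriv (\<lambda>w. \<phi> (fst p, w)) (snd p)"

text \<open>
  Holomorphy of a complex-valued function of two variables is separate: existence of the
  two complex partial derivatives, with no continuity required. It is meant for open \<open>G\<close>,
  where the partial derivatives do not depend on the values outside \<open>G\<close>.
\<close>

definition holomorphic_in_both :: "(bicomplex \<Rightarrow> complex) \<Rightarrow> bicomplex set \<Rightarrow> bool" where
  "holomorphic_in_both \<phi> G \<longleftrightarrow>
     (\<forall>p\<in>G. (\<lambda>z. \<phi> (z, snd p)) field_differentiable (at (fst p)) \<and>
            (\<lambda>w. \<phi> (fst p, w)) field_differentiable (at (snd p)))"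

end

theory Submission
  imports Defs "HOL-Complex_Analysis.Complex_Analysis"
begin

text \<open>
  For \<open>c = \<i>\<close> and \<open>c = -\<i>\<close> the ring homomorphism \<open>(a, b) \<mapsto> a + c b\<close>
  from the bicomplex to the complex numbers turns the Cauchy--Riemann equations into the single equation
  \<open>f\<^sub>b = c f\<^sub>a\<close> for \<open>f = \<phi>\<^sub>1 + c \<phi>\<^sub>2\<close>, and bicomplex differentiability
  follows once \<open>f (a, b) = F (a + c b)\<close> locally, with \<open>F\<close> holomorphic. No continuity is
  assumed, but Hartogs' theorem is not needed: by Baire, \<open>f\<close> is bounded on the product of a
  full disc in \<open>a\<close> and some small disc in \<open>b\<close>, close to the given point. There Cauchy's
  estimates make the partial derivatives continuous, so \<open>f\<close> is constant along the
  characteristics \<open>a + c b = const\<close>; the function \<open>F\<close> is read off on one slice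
  \<open>b = b\<^sub>1\<close>, and the identity theorem in \<open>b\<close> extends the formula to the given point.
\<close>

section \<open>Baire category and local uniform bounds\<close>

text \<open>The sets \<open>T n\<close> on which the whole family is bounded by \<open>n\<close> are
  closed in \<open>U\<close> by continuity and cover \<open>U\<close> by pointwise boundedness.
  Since \<open>U\<close> is open in a complete space, Baire's theorem gives one of them nonempty
  interior.\<close>

lemma uniformly_bounded_on_ball:
  fixes f :: "'i \<Rightarrow> 'a::{real_normed_vector, heine_borel} \<Rightarrow> 'b::real_normed_vector"
  assumes U: "open U" "U \<noteq> {}"
    and cont: "\<And>i. i \<in> I \<Longrightarrow> continuous_on U (f i)"
    and bdd: "\<And>x. x \<in> U \<Longrightarrow> bounded ((\<lambda>i. f i x) ` I)"
  obtains y r M where "0 < r" "ball y r \<subseteq> U"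
    "\<And>i x. i \<in> I \<Longrightarrow> x \<in> ball y r \<Longrightarrow> norm (f i x) \<le> M"
proof -
  define T where "T n = {x \<in> U. \<forall>i\<in>I. norm (f i x) \<le> real n}" for n
  have closed: "closedin (top_of_set U) (T n)" for n
  proof -
    have "T n = U \<inter> (\<Inter>i\<in>I. {x \<in> U. norm (f i x) \<in> {..real n}})" if "I \<noteq> {}"
      using that by (auto simp: T_def)
    moreover have "closedin (top_of_set U) {x \<in> U. norm (f i x) \<in> {..real n}}" if "i \<in> I" for i
      using continuous_closedin_preimage[OF continuous_on_norm[OF cont[OF that]], of "{..real n}"]
      by (simp add: vimage_def Int_def)
    ultimately show ?thesis
      by (cases "I = {}") (auto simp: T_def intro!: closedin_Int closedin_Inter)
  qed
  have cover: "\<Union>(range T) = U"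
  proof (intro equalityI subsetI)
    fix x assume x: "x \<in> U"
    obtain B where B: "\<And>i. i \<in> I \<Longrightarrow> norm (f i x) \<le> B"
      using bdd[OF x] by (auto simp: bounded_iff)
    obtain n where "B \<le> real n"
      using real_arch_simple by blast
    then show "x \<in> \<Union>(range T)"
      using x B by (force simp: T_def intro: order_trans)
  qed (auto simp: T_def)
  have "\<exists>n. top_of_set U interior_of T n \<noteq> {}"
  proof (rule ccontr)
    assume "\<not> ?thesis"
    moreover have "completely_metrizable_space (top_of_set U)"
      using completely_metrizable_space_openin[OF completely_metrizable_space_euclidean] U by simp
    ultimately have "top_of_set U interior_of \<Union>(range T) = {}"
      using closed by (intro Baire_category_alt) auto
    then show False
      using cover U interior_of_topspace[of "top_of_set U"] by simp
  qed
  then obtain n y where "y \<in> top_of_set U interior_of T n"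
    by auto
  then obtain S where S: "open S" "y \<in> S" "S \<subseteq> T n"
    using U by (auto simp: interior_of_def openin_open_eq)
  then obtain r where "r > 0" "ball y r \<subseteq> T n"
    using openE by (metis order_trans)
  then show thesis
    by (intro that[of r y "real n"]) (auto simp: T_def)
qed

section \<open>Bounded separately holomorphic functions\<close>

lemma norm_deriv_le_Cauchy:
  assumes "f holomorphic_on cball z r" "0 < r" and M: "\<And>w. w \<in> cball z r \<Longrightarrow> norm (f w) \<le> M"
  shows "norm (deriv f z) \<le> M / r"
proof -
  have "norm ((deriv ^^ 1) f z) \<le> fact 1 * M / r ^ 1"
  proof (rule Cauchy_inequality)
    show "f holomorphic_on ball z r"
      using assms(1) ball_subset_cball by (rule holomorphic_on_subset)
    show "continuous_on (cball z r) f"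
      using assms(1) by (rule holomorphic_on_imp_continuous_on)
    show "norm (f w) \<le> M" if "norm (z - w) = r" for w
      using that by (intro M) (simp add: dist_norm)
  qed (rule assms(2))
  then show ?thesis by simp
qed

text \<open>Cauchy's estimate bounds the derivative in \<open>a\<close> by \<open>M / r\<close>,
  uniformly in \<open>b\<close>. Hence \<open>f\<close> is Lipschitz in \<open>a\<close> near
  \<open>a0\<close> with a constant independent of \<open>b\<close>, and continuity in
  \<open>b\<close> is used on the slice \<open>a = a0\<close>.\<close>

lemma bounded_separately_holomorphic_continuous:
  fixes f :: "complex \<Rightarrow> complex \<Rightarrow> complex"
  assumes A: "open A" and B: "open B"
    and hol1: "\<And>b. b \<in> B \<Longrightarrow> (\<lambda>a. f a b) holomorphic_on A"
    and hol2: "\<And>a. a \<in> A \<Longrightarrow> f a holomorphic_on B"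
    and M: "\<And>a b. a \<in> A \<Longrightarrow> b \<in> B \<Longrightarrow> norm (f a b) \<le> M"
  shows "continuous_on (A \<times> B) (\<lambda>(a, b). f a b)"
proof -
  have "isCont (\<lambda>(a, b). f a b) (a0, b0)" if a0: "a0 \<in> A" and b0: "b0 \<in> B" for a0 b0
  proof -
    obtain e where e: "0 < e" "cball a0 e \<subseteq> A"
      using A a0 open_contains_cball by blast
    \<comment> \<open>Half the radius, so that closed discs of radius \<open>r\<close> about points
      of \<open>ball a0 r\<close> still lie in \<open>A\<close>.\<close>
    define r where "r = e / 2"
    have r: "0 < r" "\<And>a. a \<in> ball a0 r \<Longrightarrow> cball a r \<subseteq> A" "ball a0 r \<subseteq> A"
    proof -
      show "cball a r \<subseteq> A" if "a \<in> ball a0 r" for a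
      proof -
        have "cball a r \<subseteq> cball a0 e"
          using that by (subst cball_subset_cball_iff) (auto simp: r_def dist_commute)
        then show ?thesis using e by auto
      qed
      show "0 < r" using e by (simp add: r_def)
      show "ball a0 r \<subseteq> A" using e by (force simp: r_def)
    qed
    have lip: "norm (f a b - f a0 b) \<le> M / r * norm (a - a0)"
      if a: "a \<in> ball a0 r" and b: "b \<in> B" for a b
    proof (rule field_differentiable_bound[where S = "ball a0 r" and f' = "deriv (\<lambda>a. f a b)"])
      fix z assume z: "z \<in> ball a0 r"
      then show "((\<lambda>a. f a b) has_field_derivative deriv (\<lambda>a. f a b) z) (at z within ball a0 r)"
        using hol1[OF b] r A by (blast intro: holomorphic_derivI)
      show "norm (deriv (\<lambda>a. f a b) z) \<le> M / r"
      proof (rule norm_deriv_le_Cauchy)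
        show "(\<lambda>a. f a b) holomorphic_on cball z r"
          using hol1[OF b] r(2)[OF z] by (rule holomorphic_on_subset)
        show "norm (f w b) \<le> M" if "w \<in> cball z r" for w
          using r(2)[OF z] that b by (intro M) auto
      qed (rule r(1))
    qed (use a r in auto)
    have evA: "\<forall>\<^sub>F x in nhds (a0, b0). fst x \<in> ball a0 r \<and> snd x \<in> B"
      using eventually_nhds_in_open[OF open_Times[OF open_ball B], of "(a0, b0)" a0 r] b0 r(1)
      by (auto elim: eventually_mono)
    \<comment> \<open>Split the increment at \<open>f a0 b\<close>: the change in \<open>a\<close>
      is controlled by \<open>lip\<close>, the change in \<open>b\<close> by continuity of
      \<open>f a0\<close>.\<close>
    have "((\<lambda>x. f (fst x) (snd x) - f a0 (snd x)) \<longlongrightarrow> 0) (at (a0, b0))"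
    proof (rule Lim_null_comparison)
      show "\<forall>\<^sub>F x in at (a0, b0). norm (f (fst x) (snd x) - f a0 (snd x)) \<le> M / r * norm (fst x - a0)"
        using eventually_at_filter evA lip by (force elim!: eventually_mono simp: eventually_at_filter)
      show "((\<lambda>x. M / r * norm (fst x - a0)) \<longlongrightarrow> 0) (at (a0, b0))"
        using r(1) by (auto intro!: tendsto_eq_intros)
    qed
    moreover have "((\<lambda>x. f a0 (snd x)) \<longlongrightarrow> f a0 b0) (at (a0, b0))"
    proof -
      have "isCont (f a0) b0"
        using hol2[OF a0] B b0 continuous_on_eq_continuous_at holomorphic_on_imp_continuous_on by blast
      then show ?thesis
        by (intro isCont_tendsto_compose[of b0 "f a0" snd]) (auto intro!: tendsto_eq_intros)
    qed
    ultimately have "((\<lambda>x. f (fst x) (snd x)) \<longlongrightarrow> f a0 b0) (at (a0, b0))"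
      using tendsto_add by fastforce
    then show ?thesis by (simp add: isCont_def case_prod_unfold)
  qed
  then show ?thesis
    by (auto intro!: continuous_at_imp_continuous_on)
qed

text \<open>
  The equation \<open>f\<^sub>b = c f\<^sub>a\<close> makes each partial derivative holomorphic in the
  variable in which it was not differentiated, so that the previous lemma applies to it.
\<close>

lemma bounded_separately_holomorphic_has_derivative:
  fixes f :: "complex \<Rightarrow> complex \<Rightarrow> complex"
  assumes A: "open A" and B: "open B"
    and hol1: "\<And>b. b \<in> B \<Longrightarrow> (\<lambda>a. f a b) holomorphic_on A"
    and hol2: "\<And>a. a \<in> A \<Longrightarrow> f a holomorphic_on B"
    and M: "\<And>a b. a \<in> A \<Longrightarrow> b \<in> B \<Longrightarrow> norm (f a b) \<le> M"
    and pde: "\<And>a b. a \<in> A \<Longrightarrow> b \<in> B \<Longrightarrow> deriv (f a) b = c * deriv (\<lambda>a. f a b) a"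
    and a0: "a0 \<in> A" and b0: "b0 \<in> B"
  shows "((\<lambda>(a, b). f a b) has_derivative
      (\<lambda>(s, t). deriv (\<lambda>a. f a b0) a0 * (s + c * t))) (at (a0, b0))"
proof -
  obtain e where e: "0 < e" "cball b0 e \<subseteq> B"
    using B b0 open_contains_cball by blast
  define r where "r = e / 2"
  have r: "0 < r" "\<And>b. b \<in> ball b0 r \<Longrightarrow> cball b r \<subseteq> B" "ball b0 r \<subseteq> B"
  proof -
    show "cball b r \<subseteq> B" if "b \<in> ball b0 r" for b
    proof -
      have "cball b r \<subseteq> cball b0 e"
        using that by (subst cball_subset_cball_iff) (auto simp: r_def dist_commute)
      then show ?thesis using e by auto
    qed
    show "0 < r" using e by (simp add: r_def)
    show "ball b0 r \<subseteq> B" using e by (force simp: r_def)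
  qed
  let ?Y = "ball b0 r"
  have "continuous_on (A \<times> ?Y) (\<lambda>(a, b). deriv (f a) b)"
  proof (rule bounded_separately_holomorphic_continuous)
    show "(\<lambda>a. deriv (f a) b) holomorphic_on A" if "b \<in> ?Y" for b
    proof -
      \<comment> \<open>By \<open>pde\<close> this is the derivative in \<open>b\<close>, which is
        thereby seen to be holomorphic in \<open>a\<close>.\<close>
      have "(\<lambda>a. c * deriv (\<lambda>a. f a b) a) holomorphic_on A"
        using hol1 that r A by (intro holomorphic_intros) auto
      then show ?thesis
        using that r pde by (subst holomorphic_cong[OF refl]) auto
    qed
    show "deriv (f a) holomorphic_on ?Y" if "a \<in> A" for a
      using holomorphic_deriv[OF hol2[OF that] B] r by (blast intro: holomorphic_on_subset)
    show "norm (deriv (f a) b) \<le> M / r" if "a \<in> A" "b \<in> ?Y" for a b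
    proof (rule norm_deriv_le_Cauchy)
      show "f a holomorphic_on cball b r"
        using hol2[OF that(1)] r(2)[OF that(2)] by (rule holomorphic_on_subset)
      show "norm (f a w) \<le> M" if "w \<in> cball b r" for w
        using r(2)[OF \<open>b \<in> ?Y\<close>] that \<open>a \<in> A\<close> by (intro M) auto
    qed (rule r(1))
  qed (use A in auto)
  then have "isCont (\<lambda>(a, b). deriv (f a) b) (a0, b0)"
    using A a0 r by (subst (asm) continuous_on_eq_continuous_at) (auto intro: open_Times)
  \<comment> \<open>\<open>has_derivative_partialsI\<close> asks for continuity of the partial
    derivative as a bounded linear map, hence the passage from the number to multiplication by
    it.\<close>
  then have cont: "isCont (\<lambda>(a, b). blinfun_mult_right (deriv (f a) b)) (a0, b0)"
    unfolding case_prod_beta by (rule bounded_linear.isCont[OF bounded_linear_blinfun_mult_right])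
  have "((\<lambda>(a, b). f a b) has_derivative
      (\<lambda>(s, t). deriv (\<lambda>a. f a b0) a0 * s + blinfun_mult_right (deriv (f a0) b0) t))
      (at (a0, b0) within A \<times> ?Y)"
  proof (rule has_derivative_partialsI)
    show "((\<lambda>a. f a b0) has_derivative (*) (deriv (\<lambda>a. f a b0) a0)) (at a0 within A)"
      using holomorphic_derivI[OF hol1[OF b0] A a0] by (simp add: has_field_derivative_def)
    show "(f a has_derivative blinfun_mult_right (deriv (f a) b)) (at b within ?Y)"
      if "a \<in> A" "b \<in> ?Y" for a b
      using holomorphic_derivI[OF hol2[OF that(1)] B] that r
      by (auto simp: has_field_derivative_def)
    show "continuous (at (a0, b0) within A \<times> ?Y) (\<lambda>(a, b). blinfun_mult_right (deriv (f a) b))"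
      using cont continuous_at_imp_continuous_at_within by blast
  qed (use r in auto)
  moreover have "at (a0, b0) within A \<times> ?Y = at (a0, b0)"
    using A a0 r by (intro at_within_open) (auto intro: open_Times)
  ultimately show ?thesis
    by (simp add: pde[OF a0 b0] algebra_simps)
qed

section \<open>Characteristics and the local form of solutions\<close>

text \<open>By the chain rule, the derivative along \<open>b \<mapsto> (u - c * b, b)\<close> is the
  partial derivative in \<open>a\<close> times \<open>- c + c\<close>, hence zero; convexity of
  \<open>B\<close> then gives constancy.\<close>

lemma bounded_solution_constant_along_characteristics:
  fixes f :: "complex \<Rightarrow> complex \<Rightarrow> complex"
  assumes A: "open A" and B: "open B" "convex B"
    and hol1: "\<And>b. b \<in> B \<Longrightarrow> (\<lambda>a. f a b) holomorphic_on A"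
    and hol2: "\<And>a. a \<in> A \<Longrightarrow> f a holomorphic_on B"
    and M: "\<And>a b. a \<in> A \<Longrightarrow> b \<in> B \<Longrightarrow> norm (f a b) \<le> M"
    and pde: "\<And>a b. a \<in> A \<Longrightarrow> b \<in> B \<Longrightarrow> deriv (f a) b = c * deriv (\<lambda>a. f a b) a"
    and mem: "\<And>b. b \<in> B \<Longrightarrow> u - c * b \<in> A" and b: "b \<in> B" and b': "b' \<in> B"
  shows "f (u - c * b) b = f (u - c * b') b'"
proof -
  have "((\<lambda>b. f (u - c * b) b) has_field_derivative 0) (at b within B)" if "b \<in> B" for b
  proof -
    have "((\<lambda>b. (u - c * b, b)) has_derivative (\<lambda>t. (- c * t, t))) (at b within B)"
      by (auto intro!: derivative_eq_intros)
    from has_derivative_compose[OF this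
        bounded_separately_holomorphic_has_derivative[OF A B(1) hol1 hol2 M pde mem[OF that] that]]
    show ?thesis
      by (simp add: has_field_derivative_def case_prod_beta lambda_zero)
  qed
  from has_field_derivative_zero_constant[OF B(2) this]
  obtain k where "\<And>b. b \<in> B \<Longrightarrow> f (u - c * b) b = k"
    by blast
  then show ?thesis
    using b b' by simp
qed

lemma separately_holomorphic_solution_local_form:
  fixes f :: "complex \<Rightarrow> complex \<Rightarrow> complex"
  assumes c: "norm c = 1" and "open G" and p: "(a0, b0) \<in> G"
    and diff1: "\<And>a b. (a, b) \<in> G \<Longrightarrow> (\<lambda>a. f a b) field_differentiable at a"
    and diff2: "\<And>a b. (a, b) \<in> G \<Longrightarrow> f a field_differentiable at b"
    and pde: "\<And>a b. (a, b) \<in> G \<Longrightarrow> deriv (f a) b = c * deriv (\<lambda>a. f a b) a"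
  obtains F where "F field_differentiable at (a0 + c * b0)"
    "\<forall>\<^sub>F (a, b) in nhds (a0, b0). f a b = F (a + c * b)"
proof -
  obtain U V where UV: "open U" "open V" "a0 \<in> U" "b0 \<in> V" "U \<times> V \<subseteq> G"
    using open_prod_elim[OF \<open>open G\<close> p] by (metis mem_Sigma_iff)
  obtain e1 e2 where e: "0 < e1" "cball a0 e1 \<subseteq> U" "0 < e2" "cball b0 e2 \<subseteq> V"
    using UV open_contains_cball by metis
  define R where "R = min e1 e2"
  have R: "0 < R" "\<And>a b. a \<in> cball a0 R \<Longrightarrow> b \<in> cball b0 R \<Longrightarrow> (a, b) \<in> G"
    using e UV by (auto simp: R_def subset_iff)
  have hol1: "(\<lambda>a. f a b) holomorphic_on cball a0 R" if "b \<in> cball b0 R" for b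
    using diff1 R that by (auto simp: holomorphic_on_def intro: field_differentiable_at_within)
  have hol2: "f a holomorphic_on cball b0 R" if "a \<in> cball a0 R" for a
    using diff2 R that by (auto simp: holomorphic_on_def intro: field_differentiable_at_within)
  \<comment> \<open>With \<open>a\<close> within \<open>R / 4\<close> of \<open>a0\<close> and
    \<open>b\<close>, \<open>b'\<close> in this disc, the point \<open>a + c * (b - b')\<close> is
    within \<open>3 * R / 4\<close> of \<open>a0\<close>, so characteristics stay in the large disc
    in \<open>a\<close>.\<close>
  let ?V = "ball b0 (R / 4)"
  have V: "?V \<subseteq> cball b0 R"
    using R by auto
  \<comment> \<open>The family is indexed by \<open>a\<close>, and for fixed \<open>b\<close> its
    boundedness is compactness of \<open>cball a0 R\<close>. Only the disc in \<open>b\<close>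
    shrinks; it may miss \<open>b0\<close>.\<close>
  obtain b1 r M where br: "0 < r" "ball b1 r \<subseteq> ?V"
    and M: "\<And>a b. a \<in> cball a0 R \<Longrightarrow> b \<in> ball b1 r \<Longrightarrow> norm (f a b) \<le> M"
  proof (rule uniformly_bounded_on_ball[where f = f and U = ?V and I = "cball a0 R"])
    show "continuous_on ?V (f a)" if "a \<in> cball a0 R" for a
      using hol2[OF that] V by (meson holomorphic_on_imp_continuous_on continuous_on_subset)
    show "bounded ((\<lambda>a. f a b) ` cball a0 R)" if "b \<in> ?V" for b
      using that V hol1 by (intro compact_imp_bounded compact_continuous_image
          holomorphic_on_imp_continuous_on) auto
  qed (use R in auto)
  have V': "ball b1 r \<subseteq> cball b0 R"
    using br(2) V by (rule order_trans)
  have b1: "b1 \<in> ?V"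
    using br by (meson centre_in_ball subsetD)
  have mem: "a + c * (b - b') \<in> ball a0 R" if "a \<in> ball a0 (R / 4)" "b \<in> ?V" "b' \<in> ?V" for a b b'
  proof -
    have "norm (a + c * (b - b') - a0) \<le> norm (a - a0) + norm (b - b')"
      using norm_triangle_ineq[of "a - a0" "c * (b - b')"] c
      by (simp add: norm_mult add_diff_eq diff_add_eq)
    also have "norm (b - b') \<le> dist b0 b + dist b0 b'"
      by (metis dist_norm dist_triangle3)
    finally show ?thesis
      using that R(1) by (simp add: dist_norm norm_minus_commute)
  qed
  \<comment> \<open>The characteristic \<open>a + c * b = u\<close> meets the slice
    \<open>b = b1\<close> at \<open>a = u - c * b1\<close>.\<close>
  define F where "F u = f (u - c * b1) b1" for u
  have near: "f a b = F (a + c * b)" if a: "a \<in> ball a0 (R / 4)" and b: "b \<in> ball b1 r" for a b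
  proof -
    have "f (a + c * b - c * b) b = f (a + c * b - c * b1) b1"
    proof (rule bounded_solution_constant_along_characteristics
        [of "ball a0 R" "ball b1 r" f M c "a + c * b" b b1])
      show "a + c * b - c * b' \<in> ball a0 R" if "b' \<in> ball b1 r" for b'
        using mem[OF a subsetD[OF br(2) b] subsetD[OF br(2) that]]
        by (simp add: right_diff_distrib add_diff_eq)
      show "(\<lambda>a. f a b) holomorphic_on ball a0 R" if "b \<in> ball b1 r" for b
        using hol1[OF subsetD[OF V' that]] ball_subset_cball by (rule holomorphic_on_subset)
      show "f a holomorphic_on ball b1 r" if "a \<in> ball a0 R" for a
        using hol2[OF subsetD[OF ball_subset_cball that]] V' by (rule holomorphic_on_subset)
      show "norm (f a b) \<le> M" if "a \<in> ball a0 R" "b \<in> ball b1 r" for a b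
        using M that by auto
      show "deriv (f a) b = c * deriv (\<lambda>a. f a b) a" if "a \<in> ball a0 R" "b \<in> ball b1 r" for a b
        by (rule pde[OF R(2)[OF subsetD[OF ball_subset_cball that(1)] subsetD[OF V' that(2)]]])
    qed (use b br in auto)
    then show ?thesis
      by (simp add: F_def)
  qed
  \<comment> \<open>For fixed \<open>a\<close> both sides are holomorphic in \<open>b\<close> on the
    connected disc \<open>?V\<close> and agree on \<open>ball b1 r\<close>, so the identity theorem
    applies.\<close>
  have far: "f a b = F (a + c * b)" if a: "a \<in> ball a0 (R / 4)" and b: "b \<in> ?V" for a b
  proof (rule analytic_continuation_open[of "ball b1 r" ?V "f a" "\<lambda>b. F (a + c * b)"])
    show "f a holomorphic_on ?V"
      using hol2[of a] a V R by (auto intro: holomorphic_on_subset)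
    have "(\<lambda>a. f a b1) \<circ> (\<lambda>b. a + c * (b - b1)) holomorphic_on ?V"
      using mem[OF a _ b1] hol1[of b1] b1 V ball_subset_cball
      by (intro holomorphic_on_compose_gen[of _ _ "\<lambda>a. f a b1" "cball a0 R"] holomorphic_intros) blast+
    then show "(\<lambda>b. F (a + c * b)) holomorphic_on ?V"
      by (simp add: F_def o_def algebra_simps)
  qed (use near a b br in auto)
  show thesis
  proof (rule that)
    have "a0 + c * (b0 - b1) \<in> ball a0 R"
      using R b1 by (intro mem) auto
    then have G: "(a0 + c * b0 - c * b1, b1) \<in> G"
      using R b1 V ball_subset_cball[of a0 R] by (auto simp: algebra_simps)
    have "(\<lambda>a. f a b1) \<circ> (\<lambda>u. u - c * b1) field_differentiable at (a0 + c * b0)"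
      using diff1[OF G] by (intro field_differentiable_compose derivative_intros)
    then show "F field_differentiable at (a0 + c * b0)"
      by (simp add: F_def[abs_def] o_def)
    have "\<forall>\<^sub>F x in nhds (a0, b0). x \<in> ball a0 (R / 4) \<times> ?V"
      using R by (intro eventually_nhds_in_open open_Times) auto
    then show "\<forall>\<^sub>F (a, b) in nhds (a0, b0). f a b = F (a + c * b)"
      by eventually_elim (use far in auto)
  qed
qed

text \<open>In the local form \<open>F (a + c * b)\<close> the quotient is the ordinary difference
  quotient of \<open>F\<close> with increment \<open>fst h + c * snd h\<close>, which tends to zero
  and is nonzero on \<open>S\<close>.\<close>

lemma separately_holomorphic_solution_has_directional_limit:
  fixes f :: "complex \<Rightarrow> complex \<Rightarrow> complex"
  assumes "norm c = 1" "open G" "(a, b) \<in> G"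
    and "\<And>a b. (a, b) \<in> G \<Longrightarrow> (\<lambda>a. f a b) field_differentiable at a"
    and "\<And>a b. (a, b) \<in> G \<Longrightarrow> f a field_differentiable at b"
    and "\<And>a b. (a, b) \<in> G \<Longrightarrow> deriv (f a) b = c * deriv (\<lambda>a. f a b) a"
    and S: "\<And>h. h \<in> S \<Longrightarrow> fst h + c * snd h \<noteq> 0"
  obtains D where
    "((\<lambda>h. (f (a + fst h) (b + snd h) - f a b) / (fst h + c * snd h)) \<longlongrightarrow> D) (at 0 within S)"
proof -
  obtain F where F: "F field_differentiable at (a + c * b)"
    and eq: "\<forall>\<^sub>F (x, y) in nhds (a, b). f x y = F (x + c * y)"
    using separately_holomorphic_solution_local_form[OF assms(1-6)] by blast
  then obtain D where D: "((\<lambda>z. (F (a + c * b + z) - F (a + c * b)) / z) \<longlongrightarrow> D) (at 0)"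
    by (auto simp: field_differentiable_def DERIV_def)
  have lim: "filterlim (\<lambda>h. fst h + c * snd h) (at 0) (at 0 within S)"
    unfolding filterlim_at
    by (auto intro!: tendsto_eq_intros simp: eventually_at_filter S)
  have "filterlim (\<lambda>h. (a, b) + h) (nhds (a, b)) (at 0 within S)"
    by (auto intro!: tendsto_eq_intros)
  from eventually_compose_filterlim[OF eq this]
  have ev: "\<forall>\<^sub>F h in at 0 within S. f (a + fst h) (b + snd h) = F (a + c * b + (fst h + c * snd h))"
    by eventually_elim (auto simp: case_prod_beta algebra_simps)
  have "f a b = F (a + c * b)"
    using eventually_nhds_x_imp_x[OF eq] by simp
  then have "((\<lambda>h. (f (a + fst h) (b + snd h) - f a b) / (fst h + c * snd h)) \<longlongrightarrow> D) (at 0 within S)"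
    using filterlim_compose[OF D lim]
    by (elim Lim_transform_eventually) (use ev in \<open>auto elim: eventually_mono\<close>)
  then show thesis by (rule that)
qed

section \<open>Bicomplex division under the two complex homomorphisms\<close>

text \<open>A factorisation of the sum of squares; it lets the nonsingular increments serve as the
  set \<open>S\<close> above for both signs of \<open>c\<close>.\<close>

lemma bc_singular_iff: "bc_singular h \<longleftrightarrow> fst h + \<i> * snd h = 0 \<or> fst h + - \<i> * snd h = 0"
proof -
  have "(fst h)\<^sup>2 + (snd h)\<^sup>2 = (fst h + \<i> * snd h) * (fst h + - \<i> * snd h)"
    by (simp add: algebra_simps power2_eq_square)
  then show ?thesis
    by (simp add: bc_singular_def)
qed

text \<open>Since \<open>c\<^sup>2 = -1\<close>, the map \<open>(a, b) \<mapsto> a + c * b\<close>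
  is multiplicative, so it carries inverses to inverses.\<close>

lemma bc_divide_idempotent:
  assumes "\<not> bc_singular h" "c\<^sup>2 = -1"
  shows "fst (bc_divide r h) + c * snd (bc_divide r h) = (fst r + c * snd r) / (fst h + c * snd h)"
proof -
  have cc: "c * c = -1"
    using assms(2) by (simp add: power2_eq_square)
  have hom: "fst (p \<odot> q) + c * snd (p \<odot> q) = (fst p + c * snd p) * (fst q + c * snd q)" for p q
  proof -
    have "(fst p + c * snd p) * (fst q + c * snd q) =
        fst p * fst q + (c * c) * (snd p * snd q) + c * (snd p * fst q + fst p * snd q)"
      by (simp add: algebra_simps)
    then show ?thesis
      by (simp add: bc_mult_def cc)
  qed
  have inv: "(fst h + c * snd h) * (fst (bc_inverse h) + c * snd (bc_inverse h)) = 1"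
    using hom[of h "bc_inverse h"] bc_mult_inverse[OF assms(1)] by simp
  then have "fst (bc_inverse h) + c * snd (bc_inverse h) = 1 / (fst h + c * snd h)"
    by (simp add: eq_divide_eq mult.commute) (metis mult_zero_right zero_neq_one mult.commute)
  then show ?thesis
    by (simp add: bc_divide_def hom)
qed

section \<open>Necessity of the Cauchy-Riemann equations\<close>

text \<open>The increments \<open>(t, 0)\<close> and \<open>(0, t)\<close> with
  \<open>t \<noteq> 0\<close> are nonsingular, so the limit may be taken along either axis. Division
  by \<open>(0, t)\<close> swaps the coordinates and changes one sign, which produces the
  Cauchy-Riemann equations.\<close>

lemma bc_has_derivative_partials:
  assumes D: "bc_has_derivative \<psi> D (a, b)"
  shows "((\<lambda>z. fst (\<psi> (z, b))) has_field_derivative fst D) (at a)"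
    and "((\<lambda>z. snd (\<psi> (z, b))) has_field_derivative snd D) (at a)"
    and "((\<lambda>w. fst (\<psi> (a, w))) has_field_derivative - snd D) (at b)"
    and "((\<lambda>w. snd (\<psi> (a, w))) has_field_derivative fst D) (at b)"
proof -
  let ?q = "\<lambda>h. bc_divide (\<psi> ((a, b) + h) - \<psi> (a, b)) h"
  have lim: "((\<lambda>t. ?q (g t)) \<longlongrightarrow> D) (at 0)"
    if "(g \<longlongrightarrow> 0) (at 0)" "\<And>t. t \<noteq> 0 \<Longrightarrow> g t \<noteq> 0 \<and> \<not> bc_singular (g t)" for g :: "complex \<Rightarrow> bicomplex"
  proof -
    have "filterlim g (at 0 within {h. \<not> bc_singular h}) (at 0)"
      unfolding filterlim_at using that by (auto simp: eventually_at_filter)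
    then show ?thesis
      using D unfolding bc_has_derivative_def by (rule filterlim_compose[rotated])
  qed
  have 1: "((\<lambda>t. ?q (t, 0)) \<longlongrightarrow> D) (at 0)"
    by (rule lim) (auto simp: bc_singular_def zero_prod_def intro!: tendsto_eq_intros)
  have 2: "((\<lambda>t. ?q (0, t)) \<longlongrightarrow> D) (at 0)"
    by (rule lim) (auto simp: bc_singular_def zero_prod_def intro!: tendsto_eq_intros)
  \<comment> \<open>Division by zero yields zero, so these hold at \<open>t = 0\<close> too and
    rewrite under the limit without a side condition.\<close>
  have divide: "bc_divide r (t, 0) = (fst r / t, snd r / t)"
    "bc_divide r (0, t) = (snd r / t, - (fst r / t))" for r t
    by (cases "t = 0"; simp add: bc_divide_def bc_inverse_def bc_mult_def power2_eq_square)+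
  note simps = divide DERIV_def
  show "((\<lambda>z. fst (\<psi> (z, b))) has_field_derivative fst D) (at a)"
    using tendsto_fst[OF 1] by (simp add: simps)
  show "((\<lambda>z. snd (\<psi> (z, b))) has_field_derivative snd D) (at a)"
    using tendsto_snd[OF 1] by (simp add: simps)
  show "((\<lambda>w. fst (\<psi> (a, w))) has_field_derivative - snd D) (at b)"
    using tendsto_minus[OF tendsto_snd[OF 2]] by (simp add: simps)
  show "((\<lambda>w. snd (\<psi> (a, w))) has_field_derivative fst D) (at b)"
    using tendsto_fst[OF 2] by (simp add: simps)
qed

section \<open>Sufficiency of the Cauchy-Riemann equations\<close>

lemma bc_has_derivative_transform_open:
  assumes "open G" "p \<in> G" and eq: "\<And>q. q \<in> G \<Longrightarrow> \<psi> q = \<xi> q"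
  shows "bc_has_derivative \<psi> D p \<longleftrightarrow> bc_has_derivative \<xi> D p"
  unfolding bc_has_derivative_def
proof (rule tendsto_cong)
  have "filterlim (\<lambda>h. p + h) (nhds p) (at 0 within {h. \<not> bc_singular h})"
    by (auto intro!: tendsto_eq_intros)
  from eventually_compose_filterlim[OF eventually_nhds_in_open[OF assms(1,2)] this]
  show "\<forall>\<^sub>F h in at 0 within {h. \<not> bc_singular h}.
      bc_divide (\<psi> (p + h) - \<psi> p) h = bc_divide (\<xi> (p + h) - \<xi> p) h"
    by eventually_elim (use assms in auto)
qed

text \<open>The images of a bicomplex number under the homomorphisms for \<open>c = \<i>\<close> and
  \<open>c = - \<i>\<close> determine it linearly, so convergence of both images of the quotient
  gives convergence of the quotient.\<close>

lemma cauchy_riemann_imp_bc_has_derivative: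
  fixes \<phi> \<theta> :: "bicomplex \<Rightarrow> complex"
  assumes "open G" "p \<in> G"
    and hol: "holomorphic_in_both \<phi> G" "holomorphic_in_both \<theta> G"
    and cr: "\<And>p. p \<in> G \<Longrightarrow> partial_a \<phi> p = partial_b \<theta> p \<and> partial_a \<theta> p = - partial_b \<phi> p"
  shows "\<exists>D. bc_has_derivative (\<lambda>p. (\<phi> p, \<theta> p)) D p"
proof -
  let ?S = "{h. \<not> bc_singular h}"
  define q where "q h = bc_divide ((\<phi> (p + h), \<theta> (p + h)) - (\<phi> p, \<theta> p)) h" for h
  have ex: "\<exists>D. ((\<lambda>h. fst (q h) + c * snd (q h)) \<longlongrightarrow> D) (at 0 within ?S)"
    if c: "c = \<i> \<or> c = - \<i>" for c
  proof -
    have c2: "c\<^sup>2 = -1" and c1: "norm c = 1"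
      using c by auto
    define f where "f a b = \<phi> (a, b) + c * \<theta> (a, b)" for a b
    have diff: "(\<lambda>z. \<phi> (z, b)) field_differentiable at a" "(\<lambda>z. \<theta> (z, b)) field_differentiable at a"
       "(\<lambda>w. \<phi> (a, w)) field_differentiable at b" "(\<lambda>w. \<theta> (a, w)) field_differentiable at b"
      if "(a, b) \<in> G" for a b
      using hol that by (auto simp: holomorphic_in_both_def)
    obtain D where D: "((\<lambda>h. (f (fst p + fst h) (snd p + snd h) - f (fst p) (snd p)) / (fst h + c * snd h))
        \<longlongrightarrow> D) (at 0 within ?S)"
    proof (rule separately_holomorphic_solution_has_directional_limit[OF c1 \<open>open G\<close>, of "fst p" "snd p" f ?S])
      fix a b assume G: "(a, b) \<in> G"
      note d = diff[OF G]
      show "(\<lambda>a. f a b) field_differentiable at a" "f a field_differentiable at b"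
        unfolding f_def using d by (auto intro!: derivative_intros)
      have "deriv (f a) b = deriv (\<lambda>w. \<phi> (a, w)) b + c * deriv (\<lambda>w. \<theta> (a, w)) b"
        unfolding f_def using d by (simp add: deriv_cmult field_differentiable_mult)
      \<comment> \<open>The Cauchy-Riemann equations turn the derivatives in \<open>b\<close> into
        derivatives in \<open>a\<close>; the minus sign is absorbed as
        \<open>c\<^sup>2\<close>.\<close>
      also have "\<dots> = c * (deriv (\<lambda>z. \<phi> (z, b)) a + c * deriv (\<lambda>z. \<theta> (z, b)) a)"
        using cr[OF G] c2 by (simp add: partial_a_def partial_b_def algebra_simps power2_eq_square flip: mult.assoc)
      also have "\<dots> = c * deriv (\<lambda>a. f a b) a"
        unfolding f_def using d by (simp add: deriv_cmult field_differentiable_mult)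
      finally show "deriv (f a) b = c * deriv (\<lambda>a. f a b) a" .
    qed (use c \<open>p \<in> G\<close> in \<open>auto simp: bc_singular_iff\<close>)
    have "fst (q h) + c * snd (q h) =
        (f (fst p + fst h) (snd p + snd h) - f (fst p) (snd p)) / (fst h + c * snd h)"
      if "h \<in> ?S" for h
      using bc_divide_idempotent[OF _ c2, of h] that
      by (simp add: q_def f_def algebra_simps plus_prod_def)
    with D show ?thesis
      by (intro exI[of _ D], elim Lim_transform_eventually)
        (simp add: eventually_at_filter eventually_mono[OF eventually_True])
  qed
  obtain D where D: "((\<lambda>h. fst (q h) + \<i> * snd (q h)) \<longlongrightarrow> D) (at 0 within ?S)"
    using ex[of \<i>] by auto
  obtain E where E: "((\<lambda>h. fst (q h) + - \<i> * snd (q h)) \<longlongrightarrow> E) (at 0 within ?S)"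
    using ex[of "- \<i>"] by auto
  \<comment> \<open>The coordinates of \<open>q h\<close> are recovered as the half sum of the two
    images and their difference divided by \<open>2 * \<i>\<close>.\<close>
  have "((\<lambda>h. (((fst (q h) + \<i> * snd (q h)) + (fst (q h) + - \<i> * snd (q h))) / 2,
      ((fst (q h) + \<i> * snd (q h)) - (fst (q h) + - \<i> * snd (q h))) / (2 * \<i>)))
      \<longlongrightarrow> ((D + E) / 2, (D - E) / (2 * \<i>))) (at 0 within ?S)"
    by (intro tendsto_intros D E) auto
  then have "(q \<longlongrightarrow> ((D + E) / 2, (D - E) / (2 * \<i>))) (at 0 within ?S)"
    by simp
  then show ?thesis
    by (auto simp: bc_has_derivative_def q_def[abs_def])
qed

theorem theorem4p1:
  fixes G :: "bicomplex set"
    and \<psi> :: "bicomplex \<Rightarrow> bicomplex"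
    and \<phi>\<^sub>1 \<phi>\<^sub>2 :: "bicomplex \<Rightarrow> complex"
  assumes "open G" and "connected G"
    and "\<And>a b. (a, b) \<in> G \<Longrightarrow> \<psi> (a, b) = (\<phi>\<^sub>1 (a, b), \<phi>\<^sub>2 (a, b))"
  shows "bc_holomorphic_on \<psi> G \<longleftrightarrow>
    holomorphic_in_both \<phi>\<^sub>1 G \<and> holomorphic_in_both \<phi>\<^sub>2 G \<and>
    (\<forall>p\<in>G. partial_a \<phi>\<^sub>1 p = partial_b \<phi>\<^sub>2 p \<and> partial_a \<phi>\<^sub>2 p = - partial_b \<phi>\<^sub>1 p)"
    (is "?L \<longleftrightarrow> ?R")
proof -
  let ?\<xi> = "\<lambda>p. (\<phi>\<^sub>1 p, \<phi>\<^sub>2 p)"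
  \<comment> \<open>\<open>\<psi>\<close> is tied to its components only on \<open>G\<close>; as
    \<open>G\<close> is open, small increments stay inside, and \<open>\<psi>\<close> may be
    replaced by the pair.\<close>
  have L: "?L \<longleftrightarrow> (\<forall>p\<in>G. \<exists>D. bc_has_derivative ?\<xi> D p)"
  proof -
    have "bc_has_derivative \<psi> D p \<longleftrightarrow> bc_has_derivative ?\<xi> D p" if "p \<in> G" for D p
      using assms that by (intro bc_has_derivative_transform_open) auto
    then show ?thesis
      using \<open>open G\<close> by (simp add: bc_holomorphic_on_def bc_holomorphic_at_def interior_open)
  qed
  show ?thesis
  proof
    assume ?L
    have "(\<lambda>z. \<phi>\<^sub>1 (z, snd p)) field_differentiable at (fst p) \<and>
        (\<lambda>z. \<phi>\<^sub>2 (z, snd p)) field_differentiable at (fst p) \<and>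
        (\<lambda>w. \<phi>\<^sub>1 (fst p, w)) field_differentiable at (snd p) \<and>
        (\<lambda>w. \<phi>\<^sub>2 (fst p, w)) field_differentiable at (snd p) \<and>
        partial_a \<phi>\<^sub>1 p = partial_b \<phi>\<^sub>2 p \<and> partial_a \<phi>\<^sub>2 p = - partial_b \<phi>\<^sub>1 p"
      if p: "p \<in> G" for p
    proof -
      obtain D where "bc_has_derivative ?\<xi> D p"
        using L \<open>?L\<close> p by blast
      then have "bc_has_derivative ?\<xi> D (fst p, snd p)"
        by simp
      note bc_has_derivative_partials[OF this, unfolded fst_conv snd_conv]
      then show ?thesis
        by (auto simp: field_differentiable_def partial_a_def partial_b_def DERIV_imp_deriv)
    qed
    then show ?R
      by (simp add: holomorphic_in_both_def)
  next
    assume ?R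
    then show ?L
      unfolding L using cauchy_riemann_imp_bc_has_derivative[OF \<open>open G\<close>, of _ \<phi>\<^sub>1 \<phi>\<^sub>2] by simp
  qed
qed

end
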